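(* Let $B$ be a finite-dimensional $\mathbb{Q}$-algebra with a positive involution $*$, let $O$ be an order of $B$, let $V$ be a faithful finitely generated left $B$-module, and let $f:V\times V\to B$ be a positive-definite Hermitian form. Then any $O$-lattice $L\subseteq V$ has an orthogonal decomposition \[L=L_1\perp\cdots\perp L_r\] into indecomposable $O$-sublattices, and the set of lattices $\{L_i\}_{1\le i\le r}$ is uniquely determined by $L$ (any two such decompositions have the same set of summands).
   Context: A positive involution on $B$ is a $\mathbb{Q}$-linear map $*$ with $(ab)^*=b^*a^*$, $(a^* )^*=a$, and $\mathrm{Tr}_{B/\mathbb{Q}}(bb^* )>0$ for all nonzero $b\in B$, where $\mathrm{Tr}_{B/\mathbb{Q}}(b)$ is the trace of left multiplication by $b$ on $B$. An order of $B$ is a subring finitely generated as a $\mathbb{Z}$-module and spanning $B$ over $\mathbb{Q}$. A Hermitian form is a $\mathbb{Q}$-bilinear $f$ with $f(ax,y)=af(x,y)$, $f(y,x)=f(x,y)^*$; it is positive definite if $\mathrm{Tr}_{B/\mathbb{Q}}\circ f$ is positive definite. An $O$-lattice in $V$ is a finitely generated $\mathbb{Z}$-submodule spanning $V$ over $\mathbb{Q}$ and stable under $O$; an $O$-sublattice of $L$ is an $O$-submodule of $L$. $L=L_1\perp\cdots\perp L_r$ means $L=L_1+\dots+L_r$ with $O$-sublattices $L_i$ and $f(L_i,L_j)=0$ for $i\neq j$. A nonzero $O$-lattice $M$ is indecomposable if whenever $M=M_1+M_2$ with $O$-sublattices $M_1,M_2$ and $f(M_1,M_2)=0$, one has $M_1=0$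 or $M_2=0$. *)

theory Defs
  imports Complex_Main "HOL-Library.Set_Algebras" "HOL-Computational_Algebra.Group_Closure"
begin

text \<open>
  Rings with one are types of sort \<open>{ring, monoid_mult}\<close> rather than \<open>ring_1\<close>, because
  \<open>ring_1\<close> imposes \<open>0 \<noteq> 1\<close> and would exclude the zero algebra.
\<close>

definition fg_int_module :: "'a::ab_group_add set \<Rightarrow> bool" where
  "fg_int_module M \<longleftrightarrow> (\<exists>X. finite X \<and> M = group_closure X)"

locale fin_dim_rat_algebra = vector_space scale
  for scale :: "rat \<Rightarrow> 'b::{ring,monoid_mult} \<Rightarrow> 'b" (infixr "*\<^sub>Q" 75) +
  assumes scale_mult_left: "(q *\<^sub>Q a) * b = q *\<^sub>Q (a * b)"
    and scale_mult_right: "a * (q *\<^sub>Q b) = q *\<^sub>Q (a * b)"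
    and fin_dim: "\<exists>E. finite E \<and> span E = UNIV"
begin

text \<open>The trace over the rationals of left multiplication by \<open>b\<close>: the sum of the diagonal entries
  of its matrix with respect to some basis. All bases are finite by \<open>fin_dim\<close>, and the trace does
  not depend on the choice.\<close>

definition lmult_trace :: "'b \<Rightarrow> rat" where
  "lmult_trace b =
    (let E = (SOME E. independent E \<and> span E = UNIV)
     in \<Sum>e\<in>E. representation E (b * e) e)"

definition is_order :: "'b set \<Rightarrow> bool" where
  "is_order R \<longleftrightarrow> 1 \<in> R \<and> (\<forall>a\<in>R. \<forall>b\<in>R. a - b \<in> R \<and> a * b \<in> R) \<and>
     fg_int_module R \<and> span R = UNIV"

end

locale positive_involution = fin_dim_rat_algebra scale
  for scale :: "rat \<Rightarrow> 'b::{ring,monoid_mult} \<Rightarrow> 'b" (infixr "*\<^sub>Q" 75) +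
  fixes star :: "'b \<Rightarrow> 'b"
  assumes star_add: "star (a + b) = star a + star b"
    and star_scale: "star (q *\<^sub>Q a) = q *\<^sub>Q star a"
    and star_mult: "star (a * b) = star b * star a"
    and star_star: "star (star a) = a"
    and trace_pos: "b \<noteq> 0 \<Longrightarrow> lmult_trace (b * star b) > 0"

text \<open>The library's \<open>module\<close> locale requires commutative scalars.\<close>

locale left_module =
  fixes act :: "'b::{ring,monoid_mult} \<Rightarrow> 'v::ab_group_add \<Rightarrow> 'v"
  assumes act_add_left: "act (a + b) x = act a x + act b x"
    and act_add_right: "act a (x + y) = act a x + act a y"
    and act_mult: "act (a * b) x = act a (act b x)"
    and act_one: "act 1 x = x"
begin

definition faithful :: bool where
  "faithful \<longleftrightarrow> (\<forall>a. (\<forall>x. act a x = 0) \<longrightarrow> a = 0)"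

definition finitely_generated :: bool where
  "finitely_generated \<longleftrightarrow> (\<exists>G. finite G \<and> group_closure {act a g | a g. g \<in> G} = UNIV)"

end

locale rat_algebra_module = fin_dim_rat_algebra scale + left_module act
  for scale :: "rat \<Rightarrow> 'b::{ring,monoid_mult} \<Rightarrow> 'b" (infixr "*\<^sub>Q" 75)
    and act :: "'b \<Rightarrow> 'v::ab_group_add \<Rightarrow> 'v"
begin

definition vscale :: "rat \<Rightarrow> 'v \<Rightarrow> 'v" where
  "vscale q x = act (q *\<^sub>Q 1) x"

sublocale V: vector_space vscale
proof
  fix q r :: rat and x y :: 'v
  show "vscale q (x + y) = vscale q x + vscale q y"
    by (simp add: vscale_def act_add_right)
  show "vscale (q + r) x = vscale q x + vscale r x"
    by (simp add: vscale_def scale_left_distrib act_add_left)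
  show "vscale q (vscale r x) = vscale (q * r) x"
    by (simp add: vscale_def act_mult [symmetric] scale_mult_left)
  show "vscale 1 x = x"
    by (simp add: vscale_def act_one)
qed

definition submodule :: "'b set \<Rightarrow> 'v set \<Rightarrow> bool" where
  "submodule R M \<longleftrightarrow> 0 \<in> M \<and> (\<forall>x\<in>M. \<forall>y\<in>M. x - y \<in> M) \<and> (\<forall>a\<in>R. \<forall>x\<in>M. act a x \<in> M)"

text \<open>\<open>lattice_in R W M\<close>: \<open>M\<close> is an \<open>R\<close>-lattice in the \<open>B\<close>-submodule \<open>W\<close> of \<open>V\<close>.\<close>

definition lattice_in :: "'b set \<Rightarrow> 'v set \<Rightarrow> 'v set \<Rightarrow> bool" where
  "lattice_in R W M \<longleftrightarrow> fg_int_module M \<and> V.span M = W \<and> submodule R M"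

definition sublattice :: "'b set \<Rightarrow> 'v set \<Rightarrow> 'v set \<Rightarrow> bool" where
  "sublattice R L M \<longleftrightarrow> submodule R M \<and> M \<subseteq> L"

text \<open>Sums of subsets of \<open>V\<close>, below, are the pointwise sums of \<open>Set_Algebras\<close>; the empty sum
  is \<open>{0}\<close>. An indecomposable \<open>M\<close> is a lattice in its own rational span, which need not be
  all of \<open>V\<close>.\<close>

definition indecomposable :: "('v \<Rightarrow> 'v \<Rightarrow> 'b) \<Rightarrow> 'b set \<Rightarrow> 'v set \<Rightarrow> bool" where
  "indecomposable f R M \<longleftrightarrow> M \<noteq> {0} \<and> lattice_in R (V.span M) M \<and>
     (\<forall>M1 M2. sublattice R M M1 \<and> sublattice R M M2 \<and> M = M1 + M2 \<and>
        (\<forall>x\<in>M1. \<forall>y\<in>M2. f x y = 0) \<longrightarrow> M1 = {0} \<or> M2 = {0})"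

definition orthogonal_decomposition ::
    "('v \<Rightarrow> 'v \<Rightarrow> 'b) \<Rightarrow> 'b set \<Rightarrow> 'v set \<Rightarrow> nat \<Rightarrow> (nat \<Rightarrow> 'v set) \<Rightarrow> bool" where
  "orthogonal_decomposition f R L r Ls \<longleftrightarrow>
     (\<forall>i\<in>{1..r}. sublattice R L (Ls i)) \<and> L = (\<Sum>i\<in>{1..r}. Ls i) \<and>
     (\<forall>i\<in>{1..r}. \<forall>j\<in>{1..r}. i \<noteq> j \<longrightarrow> (\<forall>x\<in>Ls i. \<forall>y\<in>Ls j. f x y = 0))"

end

locale hermitian_module = positive_involution scale star + rat_algebra_module scale act
  for scale :: "rat \<Rightarrow> 'b::{ring,monoid_mult} \<Rightarrow> 'b" (infixr "*\<^sub>Q" 75)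
    and star :: "'b \<Rightarrow> 'b"
    and act :: "'b \<Rightarrow> 'v::ab_group_add \<Rightarrow> 'v" +
  fixes f :: "'v \<Rightarrow> 'v \<Rightarrow> 'b"
  assumes form_add_left: "f (x + y) z = f x z + f y z"
    and form_add_right: "f x (y + z) = f x y + f x z"
    and form_scale_left: "f (vscale q x) y = q *\<^sub>Q f x y"
    and form_scale_right: "f x (vscale q y) = q *\<^sub>Q f x y"
    and form_act_left: "f (act a x) y = a * f x y"
    and form_star: "f y x = star (f x y)"
begin

definition positive_definite :: bool where
  "positive_definite \<longleftrightarrow> (\<forall>x. x \<noteq> 0 \<longrightarrow> lmult_trace (f x x) > 0)"

end

end

theory Submission
  imports Defs
begin

text \<open>
  The values of \<open>q x = Tr (f x x)\<close> on \<open>L\<close> are positive and have a common denominator, and \<open>q\<close> is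
  additive on orthogonal sums. Write \<open>A\<^sup>\<bottom>\<close> for the orthogonal complement in \<open>L\<close>. If \<open>A\<close> and \<open>C\<close>
  are orthogonal summands of \<open>L\<close>, splitting a vector repeatedly along \<open>A + A\<^sup>\<bottom>\<close> and \<open>C + C\<^sup>\<bottom>\<close>
  lowers \<open>q\<close> and hence stops, so \<open>L\<close> is the sum of the four intersections of \<open>A\<close> or \<open>A\<^sup>\<bottom>\<close> with
  \<open>C\<close> or \<open>C\<^sup>\<bottom>\<close>. In particular \<open>A = A \<inter> C + A \<inter> C\<^sup>\<bottom>\<close>, and two indecomposable summands are equal or
  orthogonal. This is uniqueness. For existence, an orthogonal family of nonzero submodules is no
  larger than a generating set of \<open>L\<close>, and one of maximal size has indecomposable members.
\<close>

section \<open>Common denominators and linearity of the trace\<close>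

lemma common_denominator:
  fixes S :: "rat set"
  assumes "finite S"
  shows "\<exists>N::nat. N > 0 \<and> (\<forall>r\<in>S. of_nat N * r \<in> \<int>)"
  using assms
proof induction
  case empty
  show ?case by (intro exI[of _ 1]) simp
next
  case (insert r S)
  then obtain N :: nat where N: "N > 0" "\<forall>s\<in>S. of_nat N * s \<in> \<int>" by blast
  \<comment> \<open>The new multiplier will be the old \<open>N\<close> times the denominator
    \<open>b\<close> of \<open>r\<close>; since \<open>b\<close> is positive, \<open>nat b\<close>
    is the same number.\<close>
  obtain a b where ab: "quotient_of r = (a, b)" by fastforce
  have b: "b > 0" using quotient_of_denom_pos[OF ab] .
  have r: "of_int b * r = of_int a" using quotient_of_div[OF ab] b by simp
  have "of_nat (N * nat b) * s \<in> \<int>" if "s \<in> insert r S" for s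
  proof (cases "s = r")
    case True
    have "of_nat (nat b) = (of_int b :: rat)" using b by simp
    then have "of_nat (N * nat b) * s = of_nat N * (of_int b * r)" using True by simp
    also have "\<dots> \<in> \<int>" unfolding r by simp
    finally show ?thesis .
  next
    case False
    have "of_nat (N * nat b) * s = of_nat (nat b) * (of_nat N * s)" by simp
    then show ?thesis using N(2) False that by (metis Ints_mult Ints_of_nat insertE)
  qed
  then show ?case using N(1) b by (intro exI[of _ "N * nat b"]) simp
qed

context fin_dim_rat_algebra
begin

lemma lmult_trace_linear:
  shows "lmult_trace (a + b) = lmult_trace a + lmult_trace b"
    and "lmult_trace (q *\<^sub>Q a) = q * lmult_trace a"
proof -
  define E where "E = (SOME E. independent E \<and> span E = UNIV)"
  \<comment> \<open>The choice in \<open>E\<close> yields a basis only once some basis is known to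
    exist. After that all traces are read off in this one basis, and linearity is that of the
    coordinates.\<close>
  obtain E' where "independent E'" "UNIV \<subseteq> span E'"
    using maximal_independent_subset[of UNIV] by metis
  then have "independent E' \<and> span E' = UNIV" by auto
  then have E: "independent E" "span E = UNIV"
    unfolding E_def by (metis (mono_tags, lifting) someI_ex)+
  have tr: "lmult_trace x = (\<Sum>e\<in>E. representation E (x * e) e)" for x
    unfolding lmult_trace_def E_def Let_def ..
  show "lmult_trace (a + b) = lmult_trace a + lmult_trace b"
    unfolding tr by (simp add: distrib_right representation_add E sum.distrib)
  show "lmult_trace (q *\<^sub>Q a) = q * lmult_trace a"
    unfolding tr by (simp add: scale_mult_left representation_scale E sum_distrib_left)
qed

lemma lmult_trace_zero [simp]: "lmult_trace 0 = 0"
  using lmult_trace_linear(1)[of 0 0] by simp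

lemma lmult_trace_diff: "lmult_trace (a - b) = lmult_trace a - lmult_trace b"
  using lmult_trace_linear(1)[of "a - b" b] by simp

end

section \<open>First properties of the form\<close>

context hermitian_module
begin

lemma form_zero_left [simp]: "f 0 y = 0"
  using form_add_left[of 0 0 y] by simp

lemma form_zero_right [simp]: "f x 0 = 0"
  using form_add_right[of x 0 0] by simp

lemma form_diff_left: "f (x - y) z = f x z - f y z"
  using form_add_left[of "x - y" y z] by simp

lemma form_diff_right: "f x (y - z) = f x y - f x z"
  using form_add_right[of x "y - z" z] by simp

lemma form_sum_left: "f (\<Sum>i\<in>I. s i) y = (\<Sum>i\<in>I. f (s i) y)"
  by (induction I rule: infinite_finite_induct) (simp_all add: form_add_left)

lemma form_eq_0_sym:
  assumes "f x y = 0"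
  shows "f y x = 0"
proof -
  have "star 0 = 0" using star_add[of 0 0] by simp
  then show ?thesis by (subst form_star) (simp only: assms)
qed

lemma positive_definite_form_eq_0: "positive_definite \<Longrightarrow> f x x = 0 \<Longrightarrow> x = 0"
  unfolding positive_definite_def by (metis less_irrefl lmult_trace_zero)

section \<open>Orthogonal complements and orthogonal summands\<close>

definition orthogonal :: "'v set \<Rightarrow> 'v set \<Rightarrow> bool" where
  "orthogonal A C \<longleftrightarrow> (\<forall>x\<in>A. \<forall>y\<in>C. f x y = 0)"

lemma orthogonal_sym: "orthogonal A C \<Longrightarrow> orthogonal C A"
  unfolding orthogonal_def using form_eq_0_sym by blast

definition perp :: "'v set \<Rightarrow> 'v set \<Rightarrow> 'v set" where
  "perp L A = {x \<in> L. \<forall>a\<in>A. f x a = 0}"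

lemma submodule_zero: "submodule R M \<Longrightarrow> 0 \<in> M"
  and submodule_diff: "submodule R M \<Longrightarrow> x \<in> M \<Longrightarrow> y \<in> M \<Longrightarrow> x - y \<in> M"
  by (simp_all add: submodule_def)

lemma submodule_add: "submodule R M \<Longrightarrow> x \<in> M \<Longrightarrow> y \<in> M \<Longrightarrow> x + y \<in> M"
  using submodule_diff[of R M x "0 - y"] submodule_diff[of R M 0 y] submodule_zero[of R M] by simp

lemma submodule_Int: "submodule R M \<Longrightarrow> submodule R N \<Longrightarrow> submodule R (M \<inter> N)"
  by (simp add: submodule_def)

text \<open>The condition puts the varying vector in the first argument, where the form is linear
  over the whole algebra; hence stability under \<open>R\<close>, even if \<open>A\<close> is just a
  set.\<close>

lemma submodule_perp: "submodule R L \<Longrightarrow> submodule R (perp L A)"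
  by (simp add: submodule_def perp_def form_diff_left form_act_left)

lemma submodule_plus:
  assumes "submodule R M" "submodule R N"
  shows "submodule R (M + N)"
  unfolding submodule_def
proof (intro conjI ballI)
  show "0 \<in> M + N" using set_plus_intro[OF assms[THEN submodule_zero]] by simp
  fix x assume "x \<in> M + N"
  then obtain a b where x: "x = a + b" "a \<in> M" "b \<in> N" by (rule set_plus_elim)
  show "x - y \<in> M + N" if "y \<in> M + N" for y
  proof -
    from that obtain c d where y: "y = c + d" "c \<in> M" "d \<in> N" by (rule set_plus_elim)
    have "x - y = (a - c) + (b - d)" using x y by simp
    then show ?thesis using x y assms submodule_diff by (metis set_plus_intro)
  qed
  show "act r x \<in> M + N" if "r \<in> R" for r
    using that x assms unfolding submodule_def by (auto simp: act_add_right)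
qed

text \<open>An orthogonal complement of \<open>A\<close> inside \<open>L\<close> can only be
  \<open>perp L A\<close>, so no second submodule has to be quantified over.\<close>

definition summand :: "'b set \<Rightarrow> 'v set \<Rightarrow> 'v set \<Rightarrow> bool" where
  "summand R L A \<longleftrightarrow> sublattice R L A \<and> L \<subseteq> A + perp L A"

lemma perp_disjoint: "positive_definite \<Longrightarrow> x \<in> A \<Longrightarrow> x \<in> perp L A \<Longrightarrow> x = 0"
  unfolding perp_def using positive_definite_form_eq_0 by blast

text \<open>The orthogonal projection of \<open>L\<close> onto \<open>A\<close> carries generators
  of \<open>L\<close> to generators of \<open>A\<close>. This supplies the finite generation that
  \<open>indecomposable\<close> demands through \<open>lattice_in\<close>.\<close>

lemma summand_fg:
  assumes "positive_definite" "summand R L A" "submodule R L" "fg_int_module L"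
  shows "fg_int_module A"
proof -
  obtain X where X: "finite X" "L = group_closure X"
    using assms(4) unfolding fg_int_module_def by blast
  have A: "submodule R A" "A \<subseteq> L" using assms(2) by (auto simp: summand_def sublattice_def)
  have "\<exists>a\<in>A. x - a \<in> perp L A" if "x \<in> L" for x
  proof -
    have "x \<in> A + perp L A" using that assms(2) unfolding summand_def by blast
    then obtain a b where "x = a + b" "a \<in> A" "b \<in> perp L A" by (rule set_plus_elim)
    then show ?thesis by (intro bexI[of _ a]) simp_all
  qed
  then obtain p where p: "\<And>x. x \<in> L \<Longrightarrow> p x \<in> A \<and> x - p x \<in> perp L A" by metis
  have XL: "X \<subseteq> L" unfolding X(2) by (auto intro: group_closure.base)
  \<comment> \<open>This induction replaces a proof that \<open>p\<close> is additive: modulo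
    \<open>perp L A\<close>, every vector of \<open>L\<close> agrees with a combination of the
    projected generators.\<close>
  have proj: "\<exists>a\<in>group_closure (p ` X). y - a \<in> perp L A" if "y \<in> group_closure X" for y
    using that
  proof induction
    case (base s)
    show ?case
    \<comment> \<open>The base case of \<open>group_closure\<close> admits 0 besides the generators;
      0 serves as its own projection.\<close>
    proof (cases "s = 0")
      case True
      then show ?thesis
        using submodule_zero[OF submodule_perp[OF assms(3), of A]]
        by (intro bexI[of _ 0]) auto
    next
      case False
      then have "s \<in> X" using base by simp
      then show ?thesis using p XL by (intro bexI[of _ "p s"]) (auto intro: group_closure.base)
    qed
  next
    case (diff s t)
    then obtain a b where "a \<in> group_closure (p ` X)" "s - a \<in> perp L A"
      "b \<in> group_closure (p ` X)" "t - b \<in> perp L A" by blast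
    moreover have "s - t - (a - b) = (s - a) - (t - b)" by simp
    ultimately show ?case
      using submodule_diff[OF submodule_perp[OF assms(3), of A]]
      by (metis group_closure.diff)
  qed
  have sub: "a \<in> A" if "a \<in> group_closure (p ` X)" for a
    using that
  proof induction
    case (base s)
    then show ?case using p XL submodule_zero[OF A(1)] by blast
  next
    case (diff s t)
    then show ?case using submodule_diff[OF A(1)] by blast
  qed
  have "A \<subseteq> group_closure (p ` X)"
  proof
    fix y assume y: "y \<in> A"
    then obtain a where a: "a \<in> group_closure (p ` X)" "y - a \<in> perp L A"
      using proj A(2) X(2) by blast
    \<comment> \<open>For \<open>y\<close> in \<open>A\<close> the error term lies in both
      \<open>A\<close> and \<open>perp L A\<close>.\<close>
    then have "y - a = 0"
      using perp_disjoint[OF assms(1)] submodule_diff[OF A(1) y sub] by blast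
    then show "y \<in> group_closure (p ` X)" using a by simp
  qed
  then have "A = group_closure (p ` X)" using sub by blast
  then show ?thesis unfolding fg_int_module_def using X(1) by blast
qed

section \<open>Refining one summand along another\<close>

lemma form_denominator:
  assumes "fg_int_module L"
  shows "\<exists>N::nat. N > 0 \<and> (\<forall>x\<in>L. \<forall>y\<in>L. of_nat N * lmult_trace (f x y) \<in> \<int>)"
proof -
  obtain X where X: "finite X" "L = group_closure X"
    using assms unfolding fg_int_module_def by blast
  \<comment> \<open>Clearing denominators on the finitely many pairs of generators is enough:
    integrality spreads additively, first in the second argument and then in the first.\<close>
  have "finite ((\<lambda>(x, y). lmult_trace (f x y)) ` (X \<times> X))" using X(1) by simp
  from common_denominator[OF this] obtain N :: nat where "N > 0"
    "\<forall>r\<in>(\<lambda>(x, y). lmult_trace (f x y)) ` (X \<times> X). of_nat N * r \<in> \<int>" by blast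
  then have N: "N > 0"
    "\<And>x y. x \<in> X \<Longrightarrow> y \<in> X \<Longrightarrow> of_nat N * lmult_trace (f x y) \<in> \<int>" by auto
  have 1: "of_nat N * lmult_trace (f x y) \<in> \<int>" if "x \<in> X" "y \<in> group_closure X" for x y
    using that(2)
  proof induction
    case (base s)
    then show ?case using N(2)[OF that(1)] by (cases "s = 0") auto
  next
    case (diff s t)
    then show ?case
      by (simp add: form_diff_right lmult_trace_diff right_diff_distrib)
  qed
  have "of_nat N * lmult_trace (f x y) \<in> \<int>" if "y \<in> group_closure X" "x \<in> group_closure X" for x y
    using that(2)
  proof induction
    case (base s)
    then show ?case using 1[OF _ that(1)] by (cases "s = 0") auto
  next
    case (diff s t)
    then show ?case
      by (simp add: form_diff_left lmult_trace_diff right_diff_distrib)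
  qed
  then show ?thesis using N(1) X(2) by blast
qed

text \<open>The decomposition of all of \<open>L\<close> into four intersections is what the
  induction proves. For a vector of \<open>A\<close>, the two pieces inside \<open>perp L A\<close>
  add up to zero by positive definiteness.\<close>

lemma summand_refinement:
  assumes pos: "positive_definite" and L: "submodule R L" "fg_int_module L"
    and A: "summand R L A" and C: "summand R L C" and x: "x \<in> A"
  shows "x \<in> (A \<inter> C) + (A \<inter> perp L C)"
proof -
  have sub: "submodule R A" "A \<subseteq> L" "submodule R C" "C \<subseteq> L"
    using A C by (auto simp: summand_def sublattice_def)
  have L_split: "L \<subseteq> A + perp L A" "L \<subseteq> C + perp L C"
    using A C by (auto simp: summand_def)
  \<comment> \<open>The four intersections are grouped by their position relative to
    \<open>A\<close>.\<close>
  define P Q where "P = (A \<inter> C) + (A \<inter> perp L C)"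
    and "Q = (perp L A \<inter> C) + (perp L A \<inter> perp L C)"
  have mods: "submodule R (perp L A)" "submodule R (perp L C)"
    using submodule_perp[OF L(1)] by blast+
  have sPQ: "submodule R P" "submodule R Q"
    unfolding P_def Q_def by (intro submodule_plus submodule_Int sub mods)+
  have PQ_sub: "P \<subseteq> A" "Q \<subseteq> perp L A"
    unfolding P_def Q_def
    using submodule_add[OF sub(1)] submodule_add[OF mods(1)]
    by (auto elim!: set_plus_elim)
  obtain N :: nat where N: "N > 0" "\<forall>x\<in>L. \<forall>y\<in>L. of_nat N * lmult_trace (f x y) \<in> \<int>"
    using form_denominator[OF L(2)] by blast
  \<comment> \<open>The factor \<open>N\<close> makes \<open>q\<close> integer-valued on
    \<open>L\<close>, so \<open>nat\<close> of its floor is an exact measure there and every strict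
    drop of \<open>q\<close> is a drop of a natural number.\<close>
  define q where "q y = of_nat N * lmult_trace (f y y)" for y
  have q_pos: "q y > 0" if "y \<noteq> 0" for y
    using that pos N(1) unfolding q_def positive_definite_def by simp
  have q_add: "q (y + z) = q y + q z" if "f y z = 0" for y z
    using that form_eq_0_sym[OF that]
    by (simp add: q_def form_add_left form_add_right lmult_trace_linear distrib_left)
  have int_less: "nat \<lfloor>q y\<rfloor> < nat \<lfloor>q z\<rfloor>" if "y \<in> L" "z \<in> L" "0 \<le> q y" "q y < q z" for y z
  proof -
    have "q y \<in> \<int>" "q z \<in> \<int>" using that(1,2) N(2) unfolding q_def by blast+
    then obtain a b where "q y = of_int a" "q z = of_int b" by (metis Ints_cases)
    then show ?thesis using that(3,4) by simp
  qed
  have q_nonneg: "q y \<ge> 0" for y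
    using q_pos[of y] by (cases "y = 0") (auto simp: q_def)
  have main: "y \<in> P + Q" if "y \<in> L" for y
    using that
  proof (induction "nat \<lfloor>q y\<rfloor>" arbitrary: y rule: less_induct)
    case less
    \<comment> \<open>Both parts of a proper orthogonal splitting have smaller \<open>q\<close>, so
      the induction hypothesis covers them.\<close>
    have split: "y \<in> P + Q" if "y = u + v" "u \<in> L" "v \<in> L" "f u v = 0" "u \<noteq> 0" "v \<noteq> 0" for u v
    proof -
      have "q y = q u + q v" using q_add that by simp
      then have "q u < q y" "q v < q y" using q_pos that by fastforce+
      then have "nat \<lfloor>q u\<rfloor> < nat \<lfloor>q y\<rfloor>" "nat \<lfloor>q v\<rfloor> < nat \<lfloor>q y\<rfloor>"
        using int_less that(2,3) less.prems q_nonneg by blast+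
      then have "u \<in> P + Q" "v \<in> P + Q" using less.hyps that(2,3) by blast+
      then show ?thesis using submodule_add[OF submodule_plus[OF sPQ]] that(1) by blast
    qed
    \<comment> \<open>Here \<open>D\<close> stands for \<open>A\<close> or \<open>C\<close>: either
      \<open>y\<close> splits properly along \<open>D\<close>, or one component vanishes and
      \<open>y\<close> lies on one side.\<close>
    have dichotomy: "y \<in> P + Q \<or> y \<in> D \<or> y \<in> perp L D"
      if "L \<subseteq> D + perp L D" "D \<subseteq> L" for D
    proof -
      have "y \<in> D + perp L D" using that(1) less.prems by blast
      then obtain u v where uv: "y = u + v" "u \<in> D" "v \<in> perp L D" by (rule set_plus_elim)
      have "f u v = 0" "u \<in> L" "v \<in> L"
        using uv that(2) form_eq_0_sym[of v u] by (auto simp: perp_def)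
      then show ?thesis using split uv by (cases "u = 0"; cases "v = 0") auto
    qed
    have zero: "0 \<in> A \<inter> C" "0 \<in> A \<inter> perp L C" "0 \<in> perp L A \<inter> C" "0 \<in> perp L A \<inter> perp L C"
      "0 \<in> P" "0 \<in> Q"
      using submodule_zero[OF sub(1)] submodule_zero[OF sub(3)] submodule_zero[OF mods(1)]
        submodule_zero[OF mods(2)] submodule_zero[OF sPQ(1)] submodule_zero[OF sPQ(2)] by auto
    have inP: "P \<subseteq> P + Q" and inQ: "Q \<subseteq> P + Q"
      using set_zero_plus2[OF zero(6), of P] set_zero_plus2[OF zero(5), of Q]
      by (auto simp: add.commute)
    have pieces: "A \<inter> C \<subseteq> P" "A \<inter> perp L C \<subseteq> P" "perp L A \<inter> C \<subseteq> Q" "perp L A \<inter> perp L C \<subseteq> Q"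
      using set_zero_plus2[OF zero(2), of "A \<inter> C"] set_zero_plus2[OF zero(1), of "A \<inter> perp L C"]
      set_zero_plus2[OF zero(4), of "perp L A \<inter> C"]
      set_zero_plus2[OF zero(3), of "perp L A \<inter> perp L C"]
    unfolding P_def Q_def by (simp_all add: add.commute)
    \<comment> \<open>A vector that splits properly along neither \<open>A\<close> nor
      \<open>C\<close> already lies in one of the four intersections.\<close>
    show ?case
      using dichotomy[OF L_split(1) sub(2)] dichotomy[OF L_split(2) sub(4)] pieces inP inQ by blast
  qed
  have "x \<in> P + Q" using main x sub(2) by blast
  then obtain y z where yz: "x = y + z" "y \<in> P" "z \<in> Q" by (rule set_plus_elim)
  have "z = x - y" using yz by simp
  then have "z \<in> A" using submodule_diff[OF sub(1) x] yz PQ_sub by blast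
  then have "z = 0" using perp_disjoint[OF pos] yz(3) PQ_sub(2) by blast
  then show ?thesis using yz P_def by simp
qed

text \<open>Refinement splits \<open>A\<close> orthogonally into its parts in \<open>C\<close> and
  in \<open>perp L C\<close>, and one of them must vanish. Only \<open>A\<close> is assumed
  indecomposable, so two indecomposable summands can be compared by applying this both ways.\<close>

lemma indecomposable_summand_cases:
  assumes "positive_definite" "submodule R L" "fg_int_module L"
    and A: "summand R L A" "indecomposable f R A" and C: "summand R L C"
  shows "A \<subseteq> C \<or> orthogonal A C"
proof -
  have sub: "submodule R A" "submodule R C"
    using A C by (auto simp: summand_def sublattice_def)
  have "A = (A \<inter> C) + (A \<inter> perp L C)"
  proof
    show "A \<subseteq> (A \<inter> C) + (A \<inter> perp L C)"
      using summand_refinement[OF assms(1-3) A(1) C] by blast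
    show "(A \<inter> C) + (A \<inter> perp L C) \<subseteq> A"
      using submodule_add[OF sub(1)] by (auto elim!: set_plus_elim)
  qed
  moreover have "sublattice R A (A \<inter> C)" "sublattice R A (A \<inter> perp L C)"
    using submodule_Int sub submodule_perp[OF assms(2)] by (auto simp: sublattice_def)
  moreover have "\<forall>x\<in>A \<inter> C. \<forall>y\<in>A \<inter> perp L C. f x y = 0"
    using form_eq_0_sym unfolding perp_def by blast
  ultimately have "A \<inter> C = {0} \<or> A \<inter> perp L C = {0}"
    using A(2) unfolding indecomposable_def by blast
  with \<open>A = (A \<inter> C) + (A \<inter> perp L C)\<close> have "A = A \<inter> perp L C \<or> A = A \<inter> C"
    by (metis add.commute add_0 set_zero)
  then show ?thesis unfolding orthogonal_def perp_def by blast
qed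

section \<open>Uniqueness of the set of summands\<close>

lemma indecomposable_summands_eq_or_orthogonal:
  assumes "positive_definite" "submodule R L" "fg_int_module L"
    and A: "summand R L A" "indecomposable f R A" and C: "summand R L C" "indecomposable f R C"
  shows "A = C \<or> orthogonal A C"
  using indecomposable_summand_cases[OF assms(1-3) A C(1)]
    indecomposable_summand_cases[OF assms(1-3) C A(1)] orthogonal_sym by blast

text \<open>The terms with index other than \<open>i\<close> add up to a vector orthogonal to
  \<open>F i\<close>. The general index set serves both numbered decompositions and sets of
  submodules indexed by themselves.\<close>

lemma orthogonal_family_summand:
  assumes "finite I" "L = (\<Sum>i\<in>I. F i)" "submodule R L"
    and "\<And>i. i \<in> I \<Longrightarrow> sublattice R L (F i)"
    and orth: "\<And>i j. i \<in> I \<Longrightarrow> j \<in> I \<Longrightarrow> i \<noteq> j \<Longrightarrow> orthogonal (F i) (F j)"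
    and "i \<in> I"
  shows "summand R L (F i)"
  unfolding summand_def
proof (intro conjI subsetI)
  show "sublattice R L (F i)" using assms by blast
  fix x assume x: "x \<in> L"
  then obtain s where s: "x = sum s I" "\<forall>i\<in>I. s i \<in> F i"
    using assms(2) set_sum_alt[OF assms(1), of F] by auto
  define z where "z = (\<Sum>j\<in>I - {i}. s j)"
  have xz: "x = s i + z" unfolding s(1) z_def using sum.remove[OF assms(1,6)] .
  have "s i \<in> L" using s(2) assms(4,6) unfolding sublattice_def by blast
  moreover have "z = x - s i" using xz by simp
  ultimately have "z \<in> L" using submodule_diff[OF assms(3) x] by blast
  moreover have "f z a = 0" if "a \<in> F i" for a
    unfolding z_def form_sum_left
    using orth s(2) that assms(6) by (intro sum.neutral) (auto simp: orthogonal_def)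
  ultimately have "z \<in> perp L (F i)" unfolding perp_def by blast
  then show "x \<in> F i + perp L (F i)" using xz s(2) assms(6) by blast
qed

lemma orthogonal_to_sum:
  assumes "finite I" "\<And>i. i \<in> I \<Longrightarrow> orthogonal (F i) C"
  shows "orthogonal (\<Sum>i\<in>I. F i) C"
proof -
  have "f (sum s I) y = 0" if "\<forall>i\<in>I. s i \<in> F i" "y \<in> C" for s y
    unfolding form_sum_left using that assms(2)
    by (intro sum.neutral) (auto simp: orthogonal_def)
  then show ?thesis unfolding orthogonal_def set_sum_alt[OF assms(1)] by blast
qed

lemma orthogonal_decomposition_summand:
  assumes "submodule R L" "orthogonal_decomposition f R L r Ls" "i \<in> {1..r}"
  shows "summand R L (Ls i)"
  using assms orthogonal_family_summand[of "{1..r}" L Ls R i]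
  unfolding orthogonal_decomposition_def orthogonal_def by auto

text \<open>A summand matching none of the other decomposition would be orthogonal to all of its
  members, hence to \<open>L\<close> and to itself. The hypotheses are symmetric, so one inclusion
  suffices.\<close>

lemma indecomposable_decomposition_subset:
  assumes "positive_definite" "submodule R L" "fg_int_module L"
    and Ls: "orthogonal_decomposition f R L r Ls" "\<forall>i\<in>{1..r}. indecomposable f R (Ls i)"
    and Ls': "orthogonal_decomposition f R L r' Ls'" "\<forall>i\<in>{1..r'}. indecomposable f R (Ls' i)"
  shows "Ls ` {1..r} \<subseteq> Ls' ` {1..r'}"
proof
  fix A assume "A \<in> Ls ` {1..r}"
  then have A: "summand R L A" "indecomposable f R A"
    using orthogonal_decomposition_summand[OF assms(2) Ls(1)] Ls(2) by auto
  show "A \<in> Ls' ` {1..r'}"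
  proof (rule ccontr)
    assume notin: "A \<notin> Ls' ` {1..r'}"
    have "orthogonal (Ls' j) A" if "j \<in> {1..r'}" for j
      using indecomposable_summands_eq_or_orthogonal[OF assms(1-3) A, of "Ls' j"]
        orthogonal_decomposition_summand[OF assms(2) Ls'(1) that] Ls'(2) that notin orthogonal_sym
      by blast
    then have "orthogonal L A"
      using orthogonal_to_sum[of "{1..r'}" Ls' A] Ls'(1)
      unfolding orthogonal_decomposition_def by simp
    moreover have "A \<subseteq> L" using A(1) by (simp add: summand_def sublattice_def)
    ultimately have "x = 0" if "x \<in> A" for x
      using that positive_definite_form_eq_0[OF assms(1)] unfolding orthogonal_def by blast
    moreover have "0 \<in> A" "A \<noteq> {0}"
      using A submodule_zero unfolding summand_def sublattice_def indecomposable_def by blast+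
    ultimately show False by blast
  qed
qed

section \<open>Existence through a family of maximal size\<close>

lemma orthogonal_vectors_independent:
  assumes "positive_definite" "finite S" "0 \<notin> S"
    and orth: "\<And>x y. x \<in> S \<Longrightarrow> y \<in> S \<Longrightarrow> x \<noteq> y \<Longrightarrow> f x y = 0"
  shows "V.independent S"
proof
  assume "V.dependent S"
  then obtain u w where u: "w \<in> S" "u w \<noteq> 0" "(\<Sum>v\<in>S. vscale (u v) v) = 0"
    unfolding V.dependent_finite[OF assms(2)] by blast
  \<comment> \<open>Pairing the relation with \<open>w\<close> removes every term except that of
    \<open>w\<close> itself.\<close>
  have "0 = f (\<Sum>v\<in>S. vscale (u v) v) w" using u(3) by simp
  also have "\<dots> = (\<Sum>v\<in>S. u v *\<^sub>Q f v w)" by (simp add: form_sum_left form_scale_left)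
  also have "\<dots> = u w *\<^sub>Q f w w"
    using orth u(1) by (subst sum.remove[OF assms(2) u(1)]) (auto intro!: sum.neutral)
  finally have "f w w = 0" using u(2) by simp
  then show False using positive_definite_form_eq_0[OF assms(1)] u(1) assms(3) by blast
qed

text \<open>A set replaces the numbered family so that \<open>card\<close> counts summands. With a
  positive definite form nothing is lost, since nonzero orthogonal submodules are distinct;
  excluding \<open>{0}\<close> also makes the count bounded.\<close>

definition orthogonal_family :: "'b set \<Rightarrow> 'v set \<Rightarrow> 'v set set \<Rightarrow> bool" where
  "orthogonal_family R L F \<longleftrightarrow> finite F \<and> L = \<Sum>F \<and>
     (\<forall>A\<in>F. sublattice R L A \<and> A \<noteq> {0}) \<and> (\<forall>A\<in>F. \<forall>C\<in>F. A \<noteq> C \<longrightarrow> orthogonal A C)"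

text \<open>One nonzero vector from each member gives an orthogonal, hence independent, set of the
  same size inside the span of \<open>T\<close>.\<close>

lemma orthogonal_family_bound:
  assumes "positive_definite" "orthogonal_family R L F" "finite T" "L \<subseteq> V.span T"
  shows "card F \<le> card T"
proof -
  have F: "finite F" "\<And>A. A \<in> F \<Longrightarrow> submodule R A \<and> A \<subseteq> L \<and> A \<noteq> {0}"
    "\<And>A C. A \<in> F \<Longrightarrow> C \<in> F \<Longrightarrow> A \<noteq> C \<Longrightarrow> orthogonal A C"
    using assms(2) unfolding orthogonal_family_def sublattice_def by blast+
  have "\<forall>A\<in>F. \<exists>x\<in>A. x \<noteq> 0" using F(2) submodule_zero by blast
  then obtain g where g: "\<And>A. A \<in> F \<Longrightarrow> g A \<in> A \<and> g A \<noteq> 0" by metis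
  have orth: "f (g A) (g C) = 0" if "A \<in> F" "C \<in> F" "A \<noteq> C" for A C
    using F(3)[OF that] g that unfolding orthogonal_def by blast
  have inj: "inj_on g F"
    using orth g positive_definite_form_eq_0[OF assms(1)] by (metis inj_onI)
  have "V.independent (g ` F)"
    using F(1) g orth by (intro orthogonal_vectors_independent[OF assms(1)]) auto
  moreover have "g ` F \<subseteq> V.span T" using g F(2) assms(4) by blast
  ultimately show ?thesis
    using V.independent_span_bound[OF assms(3)] card_image[OF inj] by metis
qed

lemma orthogonal_family_refine:
  assumes "positive_definite" "orthogonal_family R L F" "A \<in> F"
    and M: "sublattice R A M1" "sublattice R A M2" "A = M1 + M2" "orthogonal M1 M2"
      "M1 \<noteq> {0}" "M2 \<noteq> {0}"
  shows "\<exists>F'. orthogonal_family R L F' \<and> card F' = Suc (card F)"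
proof -
  have F: "finite F" "L = \<Sum>F" "\<And>C. C \<in> F \<Longrightarrow> sublattice R L C \<and> C \<noteq> {0}"
    "\<And>C D. C \<in> F \<Longrightarrow> D \<in> F \<Longrightarrow> C \<noteq> D \<Longrightarrow> orthogonal C D"
    using assms(2) by (auto simp: orthogonal_family_def)
  have sub: "M1 \<subseteq> A" "M2 \<subseteq> A" using M by (auto simp: sublattice_def)
  have self: "C = {0}" if "orthogonal C C" "submodule R C" for C
    using that positive_definite_form_eq_0[OF assms(1)] submodule_zero
    unfolding orthogonal_def by blast
  have orthM: "orthogonal M1 C \<and> orthogonal M2 C \<and> orthogonal C M1 \<and> orthogonal C M2"
    if "C \<in> F - {A}" for C
    using F(4)[OF assms(3), of C] F(4)[of C A] that sub assms(3) unfolding orthogonal_def by blast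
  \<comment> \<open>Any coincidence here would make a nonzero submodule orthogonal to itself.
    Distinctness is what raises the cardinality by exactly one.\<close>
  have new: "M1 \<noteq> M2" "M1 \<notin> F - {A}" "M2 \<notin> F - {A}"
    using self M orthM unfolding sublattice_def by blast+
  let ?F = "insert M1 (insert M2 (F - {A}))"
  have "\<Sum>?F = A + \<Sum>(F - {A})" using new F(1) M(3) by (simp add: add.assoc)
  also have "\<dots> = L" using sum.remove[OF F(1) assms(3), of "\<lambda>x. x"] F(2) by simp
  finally have "L = \<Sum>?F" ..
  moreover have "sublattice R L C \<and> C \<noteq> {0}" if "C \<in> ?F" for C
    using that F(3) M sub assms(3) unfolding sublattice_def by blast
  moreover have "orthogonal C D" if "C \<in> ?F" "D \<in> ?F" "C \<noteq> D" for C D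
    using that orthM M(4) orthogonal_sym[OF M(4)] F(4) by blast
  ultimately have "orthogonal_family R L ?F"
    unfolding orthogonal_family_def using F(1) by blast
  moreover have "card ?F = Suc (card F)"
    using new F(1) card.remove[OF F(1) assms(3)] by simp
  ultimately show ?thesis by blast
qed

lemma orthogonal_family_summand_member:
  assumes "submodule R L" "orthogonal_family R L F" "A \<in> F"
  shows "summand R L A"
  using orthogonal_family_summand[of F L "\<lambda>A. A" R A] assms
  unfolding orthogonal_family_def by blast

lemma exists_indecomposable_family:
  assumes "positive_definite" "submodule R L" "fg_int_module L"
  shows "\<exists>F. orthogonal_family R L F \<and> (\<forall>A\<in>F. indecomposable f R A)"
proof -
  obtain X where X: "finite X" "L = group_closure X"
    using assms(3) unfolding fg_int_module_def by blast
  have "y \<in> V.span X" if "y \<in> group_closure X" for y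
    using that by induction (auto intro: V.span_base V.span_diff V.span_zero)
  then have bound: "card F \<le> card X" if "orthogonal_family R L F" for F
    using orthogonal_family_bound[OF assms(1) that X(1)] X(2) by blast
  \<comment> \<open>The zero lattice needs the empty family, because \<open>{0}\<close> may not be a
    member.\<close>
  have "\<exists>F. orthogonal_family R L F"
  proof (cases "L = {0}")
    case True
    then show ?thesis by (intro exI[of _ "{}"]) (simp add: orthogonal_family_def)
  next
    case False
    then show ?thesis
      using assms(2) by (intro exI[of _ "{L}"]) (simp add: orthogonal_family_def sublattice_def)
  qed
  \<comment> \<open>All cardinalities lie strictly below \<open>Suc (card X)\<close>, so a largest
    one is attained.\<close>
  then obtain F where F: "orthogonal_family R L F"
    and max: "\<And>F'. orthogonal_family R L F' \<Longrightarrow> card F' \<le> card F"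
    using ex_has_greatest_nat[of "orthogonal_family R L" _ card "Suc (card X)"] bound
    by (metis le_imp_less_Suc)
  have "indecomposable f R A" if "A \<in> F" for A
    unfolding indecomposable_def
  proof (intro conjI allI impI)
    have A: "summand R L A" using orthogonal_family_summand_member[OF assms(2) F that] .
    show "A \<noteq> {0}" using F that by (simp add: orthogonal_family_def)
    show "lattice_in R (V.span A) A"
      using A summand_fg[OF assms(1) A assms(2,3)]
      by (simp add: lattice_in_def summand_def sublattice_def)
    fix M1 M2
    assume M: "sublattice R A M1 \<and> sublattice R A M2 \<and> A = M1 + M2 \<and> (\<forall>x\<in>M1. \<forall>y\<in>M2. f x y = 0)"
    show "M1 = {0} \<or> M2 = {0}"
    \<comment> \<open>A proper orthogonal splitting of \<open>A\<close> would refine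
      \<open>F\<close> to a larger family.\<close>
    proof (rule ccontr)
      assume "\<not> (M1 = {0} \<or> M2 = {0})"
      then obtain F' where "orthogonal_family R L F'" "card F' = Suc (card F)"
        using orthogonal_family_refine[OF assms(1) F \<open>A \<in> F\<close>, of M1 M2] M
        unfolding orthogonal_def by blast
      then show False using max[of F'] by simp
    qed
  qed
  then show ?thesis using F by blast
qed

lemma orthogonal_family_enumerate:
  assumes "orthogonal_family R L F"
  shows "\<exists>r Ls. orthogonal_decomposition f R L r Ls \<and> Ls ` {1..r} = F"
proof -
  have F: "finite F" "L = \<Sum>F" using assms by (auto simp: orthogonal_family_def)
  obtain Ls where Ls: "bij_betw Ls {1..card F} F"
    using ex_bij_betw_nat_finite_1[OF F(1)] by blast
  then have img: "Ls ` {1..card F} = F" and inj: "inj_on Ls {1..card F}"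
    by (auto simp: bij_betw_def)
  have "L = (\<Sum>i\<in>{1..card F}. Ls i)"
    using sum.reindex_bij_betw[OF Ls, of "\<lambda>x. x"] F(2) by simp
  moreover have "\<forall>i\<in>{1..card F}. sublattice R L (Ls i)"
    using img assms unfolding orthogonal_family_def by blast
  moreover have "\<forall>i\<in>{1..card F}. \<forall>j\<in>{1..card F}. i \<noteq> j \<longrightarrow> orthogonal (Ls i) (Ls j)"
  proof (intro ballI impI)
    fix i j assume ij: "i \<in> {1..card F}" "j \<in> {1..card F}" "i \<noteq> j"
    then have "Ls i \<noteq> Ls j" "Ls i \<in> F" "Ls j \<in> F"
      using inj_onD[OF inj] img by blast+
    then show "orthogonal (Ls i) (Ls j)" using assms by (simp add: orthogonal_family_def)
  qed
  ultimately have "orthogonal_decomposition f R L (card F) Ls"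
    unfolding orthogonal_decomposition_def orthogonal_def by blast
  then show ?thesis using img by blast
qed

end

theorem theorem3p3:
  fixes scale :: "rat \<Rightarrow> 'b::{ring,monoid_mult} \<Rightarrow> 'b"
    and star :: "'b \<Rightarrow> 'b"
    and act :: "'b \<Rightarrow> 'v::ab_group_add \<Rightarrow> 'v"
    and f :: "'v \<Rightarrow> 'v \<Rightarrow> 'b"
    and R :: "'b set"
    and L :: "'v set"
  assumes "hermitian_module scale star act f"
    and "left_module.faithful act"
    and "left_module.finitely_generated act"
    and "hermitian_module.positive_definite scale f"
    and "fin_dim_rat_algebra.is_order scale R"
    and "rat_algebra_module.lattice_in scale act R UNIV L"
  shows "(\<exists>r Ls. rat_algebra_module.orthogonal_decomposition act f R L r Ls \<and>
           (\<forall>i\<in>{1..r}. rat_algebra_module.indecomposable scale act f R (Ls i))) \<and>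
         (\<forall>r Ls r' Ls'.
           rat_algebra_module.orthogonal_decomposition act f R L r Ls \<and>
           (\<forall>i\<in>{1..r}. rat_algebra_module.indecomposable scale act f R (Ls i)) \<and>
           rat_algebra_module.orthogonal_decomposition act f R L r' Ls' \<and>
           (\<forall>i\<in>{1..r'}. rat_algebra_module.indecomposable scale act f R (Ls' i)) \<longrightarrow>
           Ls ` {1..r} = Ls' ` {1..r'})"
proof -
  interpret hermitian_module scale star act f by (fact assms(1))
  have pos: "positive_definite" by (fact assms(4))
  have L: "submodule R L" "fg_int_module L"
    using assms(6) by (simp_all add: lattice_in_def)
  obtain F where F: "orthogonal_family R L F" "\<forall>A\<in>F. indecomposable f R A"
    using exists_indecomposable_family[OF pos L] by blast
  obtain r Ls where "orthogonal_decomposition f R L r Ls" "Ls ` {1..r} = F"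
    using orthogonal_family_enumerate[OF F(1)] by blast
  then have ex: "\<exists>r Ls. orthogonal_decomposition f R L r Ls \<and>
      (\<forall>i\<in>{1..r}. indecomposable f R (Ls i))"
    using F(2) by blast
  have "Ls ` {1..r} = Ls' ` {1..r'}"
    if "orthogonal_decomposition f R L r Ls" "\<forall>i\<in>{1..r}. indecomposable f R (Ls i)"
      "orthogonal_decomposition f R L r' Ls'" "\<forall>i\<in>{1..r'}. indecomposable f R (Ls' i)"
    for r Ls r' Ls'
    \<comment> \<open>The reordering \<open>that(3,4,1,2)\<close> exchanges the two decompositions
      and gives the reverse inclusion.\<close>
    using indecomposable_decomposition_subset[OF pos L that]
      indecomposable_decomposition_subset[OF pos L that(3,4,1,2)] by blast
  with ex show ?thesis by blast
qed

end
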